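(* Let $d\ge 2$, let $\vec\alpha=(\alpha_1,\dots,\alpha_d)\ne\vec\beta=(\beta_1,\dots,\beta_d)$ be real vectors and $\gamma$ a real number with $\alpha_1,\dots,\alpha_d,\beta_1,\dots,\beta_d,\gamma>-1$, and let $\mathbf n=(n_1,\dots,n_d),\ \mathbf m=(m_1,\dots,m_d)\in\mathbb N_0^d$. Then the function $$U^{(\vec\alpha,\vec\beta,\gamma)}_{\mathbf n,\mathbf m}(\mathbf x)=D_2\circ D_1\big[(1-|\mathbf x|)^{|\mathbf n|+|\mathbf m|}\big]$$ is a polynomial of degree $|\mathbf n|+|\mathbf m|$ and satisfies, for all $(l_1,\dots,l_d)\in\mathbb N_0^d$, $$\int_{T^d}U^{(\vec\alpha,\vec\beta,\gamma)}_{\mathbf n,\mathbf m}(\mathbf x)\,x_1^{l_1}\cdots x_d^{l_d}\,W_1(\mathbf x)\,d\mathbf x=0\quad\text{whenever } l_i<n_i\text{ for at least one } i\in\{1,\dots,d\},$$ $$\int_{T^d}U^{(\vec\alpha,\vec\beta,\gamma)}_{\mathbf n,\mathbf m}(\mathbf x)\,x_1^{l_1}\cdots x_d^{l_d}\,W_2(\mathbf x)\,d\mathbf x=0\quad\text{whenever } l_i<m_i\text{ for at least one } i\in\{1,\dots,d\}.$$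
   Context: For $\mathbf x=(x_1,\dots,x_d)$ write $|\mathbf x|=x_1+\cdots+x_d$ (likewise $|\mathbf n|$, $|\mathbf m|$ are sums of entries). Let $T^d=\{\mathbf x\in\mathbb R^d: x_1\ge 0,\dots,x_d\ge 0,\ x_1+\cdots+x_d\le 1\}$, $W_1(\mathbf x)=x_1^{\alpha_1}\cdots x_d^{\alpha_d}(1-|\mathbf x|)^\gamma$ and $W_2(\mathbf x)=x_1^{\beta_1}\cdots x_d^{\beta_d}(1-|\mathbf x|)^\gamma$. The operators are $$D_1[f(\mathbf x)]=\frac{1}{W_1(\mathbf x)}\frac{\partial^{|\mathbf n|}}{\partial x_1^{n_1}\cdots\partial x_d^{n_d}}\Big(x_1^{n_1+\alpha_1}\cdots x_d^{n_d+\alpha_d}(1-|\mathbf x|)^\gamma f(\mathbf x)\Big),$$ $$D_2[f(\mathbf x)]=\frac{1}{W_2(\mathbf x)}\frac{\partial^{|\mathbf m|}}{\partial x_1^{m_1}\cdots\partial x_d^{m_d}}\Big(x_1^{m_1+\beta_1}\cdots x_d^{m_d+\beta_d}(1-|\mathbf x|)^\gamma f(\mathbf x)\Big),$$ taken on the interior of $T^d$; "is a polynomial" means that the function coincides there with a polynomial. *)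

theory Defs
  imports "HOL-Analysis.Analysis" "HOL-Library.Poly_Mapping"
begin

text \<open>
  Vectors in d-dimensional space are elements of \<open>real ^ 'd\<close>, with d = \<open>CARD('d)\<close>;
  multi-indices are elements of \<open>nat ^ 'd\<close>. The linear order on \<open>'d\<close> only serves to fix
  the order in which mixed partial derivatives are taken.
\<close>

definition vsum :: "'a::comm_monoid_add ^ 'd \<Rightarrow> 'a" where
  "vsum x = (\<Sum>i\<in>UNIV. x $ i)"

definition monomial_fun :: "nat ^ 'd \<Rightarrow> real ^ 'd \<Rightarrow> real" where
  "monomial_fun k x = (\<Prod>i\<in>UNIV. (x $ i) ^ (k $ i))"

text \<open>Polynomials in d variables are finitely supported families of coefficients indexed by
  exponent vectors.\<close>

type_synonym 'd mpolynomial = "(nat ^ 'd) \<Rightarrow>\<^sub>0 real"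

definition mpoly_eval :: "'d::finite mpolynomial \<Rightarrow> real ^ 'd \<Rightarrow> real" where
  "mpoly_eval p x = (\<Sum>k\<in>Poly_Mapping.keys p. Poly_Mapping.lookup p k * monomial_fun k x)"

text \<open>The degree is assigned to nonzero polynomials only, so that the zero polynomial is not
  counted as one of degree 0.\<close>

definition has_total_degree :: "'d::finite mpolynomial \<Rightarrow> nat \<Rightarrow> bool" where
  "has_total_degree p N \<longleftrightarrow> p \<noteq> 0 \<and> Max (vsum ` Poly_Mapping.keys p) = N"

definition is_polynomial_of_degree_on :: "(real ^ 'd) set \<Rightarrow> (real ^ 'd \<Rightarrow> real) \<Rightarrow> nat \<Rightarrow> bool"
  where "is_polynomial_of_degree_on S f N \<longleftrightarrow>
    (\<exists>p. has_total_degree p N \<and> (\<forall>x\<in>S. f x = mpoly_eval p x))"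

definition unit_simplex :: "(real ^ 'd) set" where
  "unit_simplex = {x. (\<forall>i. 0 \<le> x $ i) \<and> vsum x \<le> 1}"

definition jacobi_weight :: "real ^ 'd \<Rightarrow> real \<Rightarrow> real ^ 'd \<Rightarrow> real" where
  "jacobi_weight a c x = (\<Prod>i\<in>UNIV. (x $ i) powr (a $ i)) * (1 - vsum x) powr c"

definition partial_deriv :: "'d::finite \<Rightarrow> (real ^ 'd \<Rightarrow> real) \<Rightarrow> real ^ 'd \<Rightarrow> real" where
  "partial_deriv i f x = deriv (\<lambda>t. f (x + t *\<^sub>R axis i 1)) 0"

definition mixed_partial ::
    "nat ^ 'd::{finite,linorder} \<Rightarrow>
    (real ^ 'd::{finite,linorder} \<Rightarrow> real) \<Rightarrow> real ^ 'd::{finite,linorder} \<Rightarrow> real" where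
  "mixed_partial k = foldr (\<lambda>i. partial_deriv i ^^ (k $ i)) (sorted_list_of_set UNIV)"

text \<open>
  The value of this operator at a point of the interior of the simplex depends only on the values of
  \<open>f\<close> in a neighbourhood of that point. Values elsewhere carry no meaning; in the
  integrals over the simplex they matter only on its boundary, a null set.
\<close>

definition rodrigues_op ::
    "real ^ 'd::{finite,linorder} \<Rightarrow> real \<Rightarrow> nat ^ 'd::{finite,linorder} \<Rightarrow>
    (real ^ 'd::{finite,linorder} \<Rightarrow> real) \<Rightarrow> real ^ 'd::{finite,linorder} \<Rightarrow> real" where
  "rodrigues_op a c k f x =
     1 / jacobi_weight a c x *
     mixed_partial k
       (\<lambda>y. (\<Prod>i\<in>UNIV. (y $ i) powr (real (k $ i) + a $ i)) * (1 - vsum y) powr c * f y) x"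

definition U_fun ::
    "real ^ 'd::{finite,linorder} \<Rightarrow> real ^ 'd::{finite,linorder} \<Rightarrow> real \<Rightarrow>
    nat ^ 'd::{finite,linorder} \<Rightarrow> nat ^ 'd::{finite,linorder} \<Rightarrow>
    real ^ 'd::{finite,linorder} \<Rightarrow> real" where
  "U_fun \<alpha> \<beta> \<gamma> n m =
     (rodrigues_op \<beta> \<gamma> m \<circ> rodrigues_op \<alpha> \<gamma> n) (\<lambda>x. (1 - vsum x) ^ (vsum n + vsum m))"

end

theory Submission
  imports Defs
begin

text \<open>
  Conjugated by \<open>(1 - |x|)\<^sup>\<gamma>\<close>, the operator \<open>D\<^sub>1\<close> is the product of the commuting factors
  \<open>x\<^sub>i \<partial>\<^sub>i + \<alpha>\<^sub>i + s\<close> with \<open>1 \<le> s \<le> n\<^sub>i\<close>, and likewise for \<open>D\<^sub>2\<close>. On the functions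
  \<open>(-1)\<^bsup>|k|\<^esup> x\<^sup>k (1 - |x|)\<^bsup>c - |k|\<^esup>\<close>, where \<open>c = \<gamma> + |n| + |m|\<close>, such a factor acts with positive
  coefficients, so no cancellation occurs in the leading form of \<open>U\<close> and its degree is \<open>|n| + |m|\<close>.
  If \<open>l\<^sub>i < n\<^sub>i\<close>, the factor with \<open>s = l\<^sub>i + 1\<close> can be applied last; multiplied by
  \<open>x\<^sup>l W\<^sub>1\<close> it becomes the exact derivative \<open>\<partial>\<^sub>i x\<^sub>i\<close> of a function vanishing at both
  ends of the range of \<open>x\<^sub>i\<close>, so its integral is zero. The same holds for \<open>W\<^sub>2\<close>, because all factors commute. The vanishing is
  checked on the explicit values of the Dirichlet integrals rather than by integration by parts.
\<close>

section \<open>Dirichlet integrals\<close>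

text \<open>Extension by zero lets integrals over the simplex be taken over the whole space: a
  product of truncated powers of the \<open>x_i\<close> and of \<open>s - |x|\<close> vanishes off
  the open simplex of size s.\<close>

definition trunc_powr :: "real \<Rightarrow> real \<Rightarrow> real" where
  "trunc_powr a y = (if 0 < y then y powr a else 0)"

lemma trunc_powr_nonneg [simp]: "0 \<le> trunc_powr a y"
  by (simp add: trunc_powr_def)

lemma borel_measurable_trunc_powr [measurable]: "trunc_powr a \<in> borel_measurable borel"
  unfolding trunc_powr_def by measurable

lemma Beta_real_nonneg:
  fixes a b :: real
  assumes "a > 0" "b > 0"
  shows "0 \<le> Beta a b"
  using assms by (auto simp: Beta_def intro!: divide_nonneg_pos mult_nonneg_nonneg
      less_imp_le[OF Gamma_real_pos] Gamma_real_pos)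

text \<open>The substitution \<open>y = s t\<close> pulls out a power of s and leaves Euler's Beta
  integral on {0..1}. For \<open>s \<le> 0\<close> the integrand is zero, since y and
  \<open>s - y\<close> cannot both be positive.\<close>

lemma nn_integral_trunc_powr_convolution:
  assumes "a > -1" "c > -1"
  shows "(\<integral>\<^sup>+y. ennreal (trunc_powr a y * trunc_powr c (s - y)) \<partial>lborel)
    = ennreal (Beta (a + 1) (c + 1) * trunc_powr (a + c + 1) s)"
proof (cases "s > 0")
  case True
  have *: "((\<lambda>t. t powr a * (1 - t) powr c) has_integral Beta (a + 1) (c + 1)) {0..1}"
    using has_integral_Beta_real[of "a + 1" "c + 1"] assms by simp
  have "(\<integral>\<^sup>+y. ennreal (trunc_powr a y * trunc_powr c (s - y)) \<partial>lborel)
    = ennreal \<bar>s\<bar> * (\<integral>\<^sup>+t. ennreal (trunc_powr a (s * t) * trunc_powr c (s - s * t)) \<partial>lborel)"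
    using True by (subst nn_integral_real_affine[where c = s and t = 0]) auto
  also have "(\<integral>\<^sup>+t. ennreal (trunc_powr a (s * t) * trunc_powr c (s - s * t)) \<partial>lborel)
    = (\<integral>\<^sup>+t. ennreal (s powr (a + c)) * (ennreal (t powr a * (1 - t) powr c) * indicator {0..1} t) \<partial>lborel)"
  proof (rule nn_integral_cong)
    fix t :: real
    have "trunc_powr a (s * t) = s powr a * trunc_powr a t"
      using True by (auto simp: trunc_powr_def powr_mult zero_less_mult_iff)
    moreover have "trunc_powr c (s - s * t) = s powr c * trunc_powr c (1 - t)"
    proof -
      have "s - s * t = s * (1 - t)" by (simp add: algebra_simps)
      then show ?thesis
        using True by (auto simp: trunc_powr_def powr_mult zero_less_mult_iff)
    qed
    \<comment> \<open>At the endpoints both sides are 0 because \<open>0 powr a = 0\<close>, so the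
      closed interval is admissible.\<close>
    moreover have "trunc_powr a t * trunc_powr c (1 - t)
        = t powr a * (1 - t) powr c * indicator {0..1} t"
      by (auto simp: trunc_powr_def indicator_def)
    ultimately have "trunc_powr a (s * t) * trunc_powr c (s - s * t)
        = s powr (a + c) * (t powr a * (1 - t) powr c * indicator {0..1} t)"
      by (simp add: powr_add mult_ac)
    then show "ennreal (trunc_powr a (s * t) * trunc_powr c (s - s * t))
        = ennreal (s powr (a + c)) * (ennreal (t powr a * (1 - t) powr c) * indicator {0..1} t)"
      by (simp add: ennreal_mult' flip: ennreal_indicator)
  qed
  also have "\<dots> = ennreal (s powr (a + c)) * ennreal (Beta (a + 1) (c + 1))"
    using nn_integral_has_integral_lebesgue'[OF _ *] by (subst nn_integral_cmult) auto
  also have "ennreal \<bar>s\<bar> * \<dots> = ennreal (Beta (a + 1) (c + 1) * trunc_powr (a + c + 1) s)"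
    using True Beta_real_nonneg[of "a + 1" "c + 1"] assms
    by (simp add: trunc_powr_def powr_add mult_ac flip: ennreal_mult)
  finally show ?thesis .
next
  case False
  then have *: "trunc_powr a y * trunc_powr c (s - y) = 0" for y
    by (auto simp: trunc_powr_def)
  show ?thesis
    unfolding * using False by (simp add: trunc_powr_def)
qed

text \<open>Dirichlet's closed form of the integral of the product of the
  \<open>x_i powr a i\<close> and \<open>(1 - |x|) powr c\<close> over the simplex in the
  coordinates I. The index set is a parameter so that coordinates can be added one at a
  time.\<close>

definition dirichlet_const :: "('i \<Rightarrow> real) \<Rightarrow> real \<Rightarrow> 'i set \<Rightarrow> real" where
  "dirichlet_const a c I = (\<Prod>i\<in>I. Gamma (a i + 1)) * Gamma (c + 1) / Gamma (c + 1 + (\<Sum>i\<in>I. a i + 1))"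

lemma dirichlet_const_nonneg:
  assumes "\<And>i. i \<in> I \<Longrightarrow> a i > -1" "c > -1"
  shows "0 \<le> dirichlet_const a c I"
proof -
  have pos: "a i + 1 > 0" if "i \<in> I" for i
    using assms(1)[OF that] by linarith
  have c: "c + 1 > 0"
    using assms(2) by linarith
  have "c + 1 + (\<Sum>i\<in>I. a i + 1) > 0"
    using pos by (intro add_pos_nonneg[OF c] sum_nonneg) (auto intro: less_imp_le)
  then show ?thesis
    unfolding dirichlet_const_def using pos c
    by (intro divide_nonneg_pos mult_nonneg_nonneg prod_nonneg Gamma_real_pos
        less_imp_le[OF Gamma_real_pos]) auto
qed

text \<open>Induction on the set of coordinates: by Tonelli the new coordinate is integrated first,
  as a convolution of truncated powers. This replaces c by \<open>c + a i + 1\<close>, hence the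
  generalisation over c.\<close>

lemma nn_integral_dirichlet_PiM:
  fixes a :: "'i \<Rightarrow> real"
  assumes "finite I" "\<And>i. i \<in> I \<Longrightarrow> a i > -1" "c > -1"
  shows "(\<integral>\<^sup>+x. ennreal ((\<Prod>i\<in>I. trunc_powr (a i) (x i)) * trunc_powr c (s - (\<Sum>i\<in>I. x i))) \<partial>(\<Pi>\<^sub>M i\<in>I. lborel))
    = ennreal (dirichlet_const a c I * trunc_powr (c + (\<Sum>i\<in>I. a i + 1)) s)"
  using assms
proof (induction I arbitrary: c rule: finite_induct)
  case empty
  then have "Gamma (c + 1) > 0" by (intro Gamma_real_pos) auto
  then show ?case
    by (simp add: dirichlet_const_def nn_integral_empty PiM_empty nn_integral_count_space_finite)
next
  case (insert i I c)
  interpret product_sigma_finite "\<lambda>i::'i. lborel :: real measure" by standard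
  have pos: "a i + 1 > 0" "c + 1 > 0"
    using insert.prems(1)[of i] insert.prems(2) by auto
  \<comment> \<open>This Gamma value is the denominator of the Beta factor and a numerator factor of
    the constant for I; the two cancel at the end.\<close>
  have Gamma_nz: "Gamma (c + (a i + 2)) \<noteq> 0"
    using Gamma_real_pos[of "c + (a i + 2)"] pos by linarith
  let ?P = "\<lambda>x. \<Prod>j\<in>I. trunc_powr (a j) (x j)"
  have "(\<integral>\<^sup>+x. ennreal ((\<Prod>j\<in>insert i I. trunc_powr (a j) (x j)) * trunc_powr c (s - (\<Sum>j\<in>insert i I. x j))) \<partial>(\<Pi>\<^sub>M i\<in>insert i I. lborel))
     = (\<integral>\<^sup>+x. (\<integral>\<^sup>+y. ennreal ((\<Prod>j\<in>insert i I. trunc_powr (a j) ((x(i := y)) j))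
          * trunc_powr c (s - (\<Sum>j\<in>insert i I. (x(i := y)) j))) \<partial>lborel) \<partial>(\<Pi>\<^sub>M i\<in>I. lborel))"
    using insert.hyps by (intro product_nn_integral_insert) (auto simp del: prod.insert sum.insert)
  also have "\<dots> = (\<integral>\<^sup>+x. ennreal (Beta (a i + 1) (c + 1)) *
      ennreal (?P x * trunc_powr (c + (a i + 1)) (s - (\<Sum>j\<in>I. x j))) \<partial>(\<Pi>\<^sub>M i\<in>I. lborel))"
  proof (rule nn_integral_cong)
    fix x :: "'i \<Rightarrow> real"
    have nn: "0 \<le> ?P x" by (simp add: prod_nonneg)
    have B: "0 \<le> Beta (a i + 1) (c + 1)"
      by (rule Beta_real_nonneg[OF pos])
    have "(\<Prod>j\<in>insert i I. trunc_powr (a j) ((x(i := y)) j)) = trunc_powr (a i) y * ?P x" for y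
      using insert.hyps by (simp, intro disjI2 prod.cong) auto
    moreover have "(\<Sum>j\<in>insert i I. (x(i := y)) j) = y + (\<Sum>j\<in>I. x j)" for y
      using insert.hyps by (simp, intro sum.cong) auto
    ultimately have "(\<integral>\<^sup>+y. ennreal ((\<Prod>j\<in>insert i I. trunc_powr (a j) ((x(i := y)) j))
          * trunc_powr c (s - (\<Sum>j\<in>insert i I. (x(i := y)) j))) \<partial>lborel)
        = (\<integral>\<^sup>+y. ennreal (?P x) * ennreal (trunc_powr (a i) y * trunc_powr c ((s - (\<Sum>j\<in>I. x j)) - y)) \<partial>lborel)"
      using nn by (intro nn_integral_cong)
        (simp add: mult.assoc mult.left_commute diff_diff_eq add.commute flip: ennreal_mult)
    also have "\<dots> = ennreal (?P x) * ennreal (Beta (a i + 1) (c + 1) * trunc_powr (a i + c + 1) (s - (\<Sum>j\<in>I. x j)))"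
      using insert.prems by (subst nn_integral_cmult) (auto simp: nn_integral_trunc_powr_convolution)
    also have "\<dots> = ennreal (Beta (a i + 1) (c + 1)) *
      ennreal (?P x * trunc_powr (c + (a i + 1)) (s - (\<Sum>j\<in>I. x j)))"
      using nn B by (simp add: mult_ac add_ac flip: ennreal_mult)
    finally show "(\<integral>\<^sup>+y. ennreal ((\<Prod>j\<in>insert i I. trunc_powr (a j) ((x(i := y)) j))
          * trunc_powr c (s - (\<Sum>j\<in>insert i I. (x(i := y)) j))) \<partial>lborel) = \<dots>" .
  qed
  also have "\<dots> = ennreal (Beta (a i + 1) (c + 1)) *
      ennreal (dirichlet_const a (c + (a i + 1)) I * trunc_powr (c + (a i + 1) + (\<Sum>j\<in>I. a j + 1)) s)"
    using insert.prems pos by (subst nn_integral_cmult, measurable) (subst insert.IH, auto)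
  also have "\<dots> = ennreal (Beta (a i + 1) (c + 1) * dirichlet_const a (c + (a i + 1)) I
      * trunc_powr (c + (a i + 1) + (\<Sum>j\<in>I. a j + 1)) s)"
    using pos insert.prems
    by (subst ennreal_mult'[symmetric]) (auto intro!: mult_nonneg_nonneg dirichlet_const_nonneg Beta_real_nonneg simp: mult_ac)
  also have "Beta (a i + 1) (c + 1) * dirichlet_const a (c + (a i + 1)) I = dirichlet_const a c (insert i I)"
    using insert.hyps Gamma_nz
    by (simp add: dirichlet_const_def Beta_def add_ac)
  also have "c + (a i + 1) + (\<Sum>j\<in>I. a j + 1) = c + (\<Sum>j\<in>insert i I. a j + 1)"
    using insert.hyps by simp
  finally show ?case .
qed

section \<open>The simplex, its boundary, and Lebesgue measure in coordinates\<close>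

lemma interior_unit_simplex:
  "interior (unit_simplex :: (real ^ 'd::finite) set) = {x. (\<forall>i. 0 < x $ i) \<and> vsum x < 1}"
proof -
  have Basis: "(Basis :: (real ^ 'd::finite) set) = range (\<lambda>i. axis i 1)"
    by (auto simp: Basis_vec_def)
  have sum: "(\<Sum>b\<in>(Basis :: (real ^ 'd::finite) set). x \<bullet> b) = vsum x" for x
    unfolding Basis by (subst sum.reindex) (auto simp: inj_on_def axis_eq_axis vsum_def inner_axis)
  \<comment> \<open>The interior of the convex hull of the origin and the standard basis is
    known.\<close>
  have eq: "unit_simplex = convex hull (insert 0 (Basis :: (real ^ 'd::finite) set))"
    unfolding std_simplex sum unit_simplex_def by (auto simp: Basis inner_axis)
  show ?thesis
    unfolding eq interior_std_simplex sum by (auto simp: Basis inner_axis)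
qed

text \<open>The frontier of a convex set is a null set.\<close>

lemma negligible_unit_simplex_boundary:
  "negligible (unit_simplex - interior (unit_simplex :: (real ^ 'd::finite) set))"
proof -
  have "convex (unit_simplex :: (real ^ 'd::finite) set)"
    unfolding convex_def unit_simplex_def vsum_def
    by (auto simp: sum.distrib simp flip: sum_distrib_left intro!: convex_bound_le)
  then show ?thesis
    by (rule negligible_subset[OF negligible_convex_frontier])
      (use closure_subset in \<open>auto simp: frontier_def\<close>)
qed

text \<open>The product measure is the image of Lebesgue measure under reading a vector as a
  function of its index. It suffices to compare the two on boxes, where both give the product of the
  side measures.\<close>

lemma nn_integral_lborel_vec:
  fixes f :: "('d::finite \<Rightarrow> real) \<Rightarrow> ennreal"
  assumes [measurable]: "f \<in> borel_measurable (\<Pi>\<^sub>M i\<in>UNIV. lborel)"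
  shows "(\<integral>\<^sup>+x. f (\<lambda>i. x $ i) \<partial>(lborel :: (real ^ 'd::finite) measure)) = (\<integral>\<^sup>+x. f x \<partial>(\<Pi>\<^sub>M i\<in>UNIV. lborel))"
proof -
  interpret product_sigma_finite "\<lambda>i::'d. lborel :: real measure" by standard
  have [measurable]: "(\<lambda>x :: real ^ 'd. \<lambda>i. x $ i) \<in> borel \<rightarrow>\<^sub>M (\<Pi>\<^sub>M i\<in>UNIV. lborel)"
    by (rule measurable_PiM_single') (auto simp: space_PiM)
  have PiM_distr: "(\<Pi>\<^sub>M i\<in>UNIV. lborel) = distr (lborel :: (real ^ 'd::finite) measure) (\<Pi>\<^sub>M i\<in>UNIV. lborel) (\<lambda>x i. x $ i)"
  proof (rule PiM_eqI[symmetric])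
    fix A :: "'d \<Rightarrow> real set"
    assume A: "\<And>i. i \<in> UNIV \<Longrightarrow> A i \<in> sets lborel"
    note [measurable] = A[simplified]
    have Basis: "(Basis :: (real ^ 'd) set) = range (\<lambda>i. axis i 1)"
      by (auto simp: Basis_vec_def)
    have prod: "(\<Prod>b\<in>(Basis :: (real ^ 'd) set). h b) = (\<Prod>i\<in>UNIV. h (axis i 1))"
      for h :: "real ^ 'd \<Rightarrow> 'c::comm_monoid_mult"
      unfolding Basis by (subst prod.reindex) (auto simp: inj_on_def axis_eq_axis)
    have "emeasure (distr (lborel :: (real ^ 'd) measure) (\<Pi>\<^sub>M i\<in>UNIV. lborel) (\<lambda>x i. x $ i)) (Pi\<^sub>E UNIV A)
      = emeasure lborel {x :: real ^ 'd. \<forall>i. x $ i \<in> A i}"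
      by (subst emeasure_distr) (auto intro!: arg_cong[of _ _ "emeasure lborel"] simp: PiE_iff)
    also have "\<dots> = (\<integral>\<^sup>+x. indicator {x :: real ^ 'd. \<forall>i. x $ i \<in> A i} x \<partial>lborel)"
      by (subst nn_integral_indicator) auto
    \<comment> \<open>The product formula for \<open>lborel\<close> runs over basis vectors;
      \<open>axis_index\<close> recovers the coordinate from the vector.\<close>
    also have "\<dots> = (\<integral>\<^sup>+x. (\<Prod>b\<in>Basis. indicator (A (axis_index b)) (x \<bullet> b)) \<partial>(lborel :: (real ^ 'd) measure))"
      unfolding prod by (intro nn_integral_cong) (auto simp: indicator_def inner_axis)
    also have "\<dots> = (\<Prod>b\<in>(Basis :: (real ^ 'd) set). \<integral>\<^sup>+x. ennreal (indicator (A (axis_index b)) x) \<partial>lborel)"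
      by (subst nn_integral_lborel_prod[symmetric]) (auto simp flip: ennreal_indicator prod_ennreal)
    also have "\<dots> = (\<Prod>i\<in>UNIV. emeasure lborel (A i))"
      unfolding prod by (simp add: ennreal_indicator)
    finally show "emeasure (distr (lborel :: (real ^ 'd) measure) (\<Pi>\<^sub>M i\<in>UNIV. lborel) (\<lambda>x i. x $ i)) (Pi\<^sub>E UNIV A)
      = (\<Prod>i\<in>UNIV. emeasure lborel (A i))" .
  qed auto
  have "(\<integral>\<^sup>+x. f x \<partial>(\<Pi>\<^sub>M i\<in>UNIV. lborel))
    = (\<integral>\<^sup>+x. f x \<partial>distr (lborel :: (real ^ 'd) measure) (\<Pi>\<^sub>M i\<in>UNIV. lborel) (\<lambda>x i. x $ i))"
    by (simp only: PiM_distr[symmetric])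
  also have "\<dots> = (\<integral>\<^sup>+x. f (\<lambda>i. x $ i) \<partial>(lborel :: (real ^ 'd) measure))"
    by (rule nn_integral_distr) auto
  finally show ?thesis by simp
qed

section \<open>Integrals of Jacobi weights\<close>

lemma borel_measurable_jacobi_weight [measurable]:
  "jacobi_weight a c \<in> borel_measurable borel"
  unfolding jacobi_weight_def vsum_def by measurable

text \<open>Off the open simplex at least one truncated factor is zero, so the right-hand side
  already contains the indicator.\<close>

lemma jacobi_weight_trunc_powr:
  "indicator (interior unit_simplex) x * jacobi_weight a c x
    = (\<Prod>i\<in>UNIV. trunc_powr (a $ i) (x $ i)) * trunc_powr c (1 - vsum x)"
  unfolding interior_unit_simplex
  by (auto simp: indicator_def jacobi_weight_def trunc_powr_def intro!: prod_zero)

lemma has_bochner_integral_dirichlet: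
  fixes a :: "real ^ 'd::finite"
  assumes "\<And>i. a $ i > -1" "c > -1"
  shows "has_bochner_integral lborel
    (\<lambda>x. indicator (interior unit_simplex) x * jacobi_weight a c x) (dirichlet_const (($) a) c UNIV)"
  unfolding jacobi_weight_trunc_powr
proof (rule has_bochner_integral_nn_integral)
  show "(\<lambda>x :: real ^ 'd. (\<Prod>i\<in>UNIV. trunc_powr (a $ i) (x $ i)) * trunc_powr c (1 - vsum x))
      \<in> borel_measurable lborel"
    unfolding vsum_def by measurable
  show "AE x :: real ^ 'd in lborel. 0 \<le> (\<Prod>i\<in>UNIV. trunc_powr (a $ i) (x $ i)) * trunc_powr c (1 - vsum x)"
    by (simp add: prod_nonneg)
  show "0 \<le> dirichlet_const (($) a) c UNIV"
    using assms by (intro dirichlet_const_nonneg) auto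
  have "(\<integral>\<^sup>+x. ennreal ((\<Prod>i\<in>UNIV. trunc_powr (a $ i) (x $ i)) * trunc_powr c (1 - vsum x)) \<partial>(lborel :: (real ^ 'd) measure))
    = (\<integral>\<^sup>+x. ennreal ((\<Prod>i\<in>UNIV. trunc_powr (a $ i) (x i)) * trunc_powr c (1 - (\<Sum>i\<in>UNIV. x i))) \<partial>(\<Pi>\<^sub>M i\<in>UNIV. lborel))"
    unfolding vsum_def by (subst nn_integral_lborel_vec[symmetric]) auto
  \<comment> \<open>The Dirichlet formula at \<open>s = 1\<close>, where its truncated power equals
    1.\<close>
  also have "\<dots> = ennreal (dirichlet_const (($) a) c UNIV)"
    using assms by (subst nn_integral_dirichlet_PiM) (auto simp: trunc_powr_def)
  finally show "(\<integral>\<^sup>+x. ennreal ((\<Prod>i\<in>UNIV. trunc_powr (a $ i) (x $ i)) * trunc_powr c (1 - vsum x)) \<partial>(lborel :: (real ^ 'd) measure))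
    = ennreal (dirichlet_const (($) a) c UNIV)" .
qed

lemma absolutely_integrable_jacobi_weight:
  fixes a :: "real ^ 'd::finite"
  assumes "\<And>i. a $ i > -1" "c > -1"
  shows "jacobi_weight a c absolutely_integrable_on interior unit_simplex"
  using has_bochner_integral_dirichlet[OF assms]
  by (auto simp: set_integrable_def has_bochner_integral_iff integrable_completion)

lemma integral_jacobi_weight:
  fixes a :: "real ^ 'd::finite"
  assumes "\<And>i. a $ i > -1" "c > -1"
  shows "(LINT x:interior unit_simplex|lebesgue. jacobi_weight a c x) = dirichlet_const (($) a) c UNIV"
  using has_bochner_integral_dirichlet[OF assms]
  by (auto simp: set_lebesgue_integral_def has_bochner_integral_iff integral_completion)

text \<open>The vanishing of the integral of \<open>\<partial>_i (x_i x^a (1 - |x|)^c)\<close>,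
  expressed in closed form. Raising \<open>a_i\<close> and lowering c by one keeps the Gamma
  denominator; \<open>Gamma (z + 1) = z * Gamma z\<close> accounts for the two numerator factors
  that change.\<close>

lemma dirichlet_const_recurrence:
  fixes a :: "real ^ 'd::finite"
  assumes "\<And>i. a $ i > -1" "c > 0"
  shows "(a $ i + 1) * dirichlet_const (($) a) c UNIV
    = c * dirichlet_const (($) (a + axis i 1)) (c - 1) UNIV"
proof -
  have "(\<Prod>j\<in>UNIV. Gamma ((a + axis i 1) $ j + 1))
      = Gamma (a $ i + 2) * (\<Prod>j\<in>UNIV - {i}. Gamma (a $ j + 1))"
    by (subst prod.remove[of _ i]) (auto simp: axis_def add_ac intro!: prod.cong)
  also have "Gamma (a $ i + 2) = (a $ i + 1) * Gamma (a $ i + 1)"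
    using Gamma_plus1[of "a $ i + 1"] assms(1)[of i] nonpos_Ints_nonpos[of "a $ i + 1"]
    by (force simp: add_ac)
  also have "\<dots> * (\<Prod>j\<in>UNIV - {i}. Gamma (a $ j + 1)) = (a $ i + 1) * (\<Prod>j\<in>UNIV. Gamma (a $ j + 1))"
    by (subst (2) prod.remove[of _ i]) auto
  finally have 1: "(\<Prod>j\<in>UNIV. Gamma ((a + axis i 1) $ j + 1)) = \<dots>" .
  have 2: "(\<Sum>j\<in>UNIV. (a + axis i 1) $ j + 1) = (\<Sum>j\<in>UNIV. a $ j + 1) + 1"
    by (simp add: sum.distrib axis_def)
  have 3: "Gamma (c + 1) = c * Gamma c"
    using Gamma_plus1[of c] assms(2) nonpos_Ints_nonpos[of c] by force
  show ?thesis
    unfolding dirichlet_const_def 1 2 3 by (simp add: algebra_simps)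
qed

section \<open>Euler operators\<close>

definition real_vec :: "nat ^ 'd \<Rightarrow> real ^ 'd" where
  "real_vec k = (\<chi> i. real (k $ i))"

lemma real_vec_nth [simp]: "real_vec k $ i = real (k $ i)"
  by (simp add: real_vec_def)

lemma real_vec_add_axis: "real_vec (k + axis i 1) = real_vec k + axis i 1"
  by (simp add: vec_eq_iff axis_def)

lemma axis_component: "axis i c $ j = (if j = i then c else 0)"
  by (simp add: axis_def)

lemma vsum_add: "vsum (k + l) = vsum k + vsum l"
  by (simp add: vsum_def sum.distrib)

lemma vsum_axis [simp]: "vsum (axis i c) = c"
  by (simp add: vsum_def axis_def)

lemma vsum_scaleR: "vsum (c *\<^sub>R x) = c * vsum (x :: real ^ 'd)"
  by (simp add: vsum_def sum_distrib_left)

lemma vsum_diff_axis: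
  fixes k :: "nat ^ 'd::finite"
  assumes "k $ i > 0"
  shows "vsum k = Suc (vsum (k - axis i 1))"
proof -
  have "k = (k - axis i 1) + axis i 1"
    using assms by (auto simp: vec_eq_iff axis_component)
  then show ?thesis
    by (metis vsum_add vsum_axis Suc_eq_plus1)
qed

lemma nth_le_vsum: "k $ i \<le> vsum (k :: nat ^ 'd::finite)"
  unfolding vsum_def by (rule member_le_sum) auto

lemma finite_vsum_le [simp]: "finite {k :: nat ^ 'd::finite. vsum k \<le> N}"
proof (rule finite_subset)
  show "{k :: nat ^ 'd. vsum k \<le> N} \<subseteq> vec_lambda ` (UNIV \<rightarrow>\<^sub>E {..N})"
  proof
    fix k :: "nat ^ 'd"
    assume "k \<in> {k. vsum k \<le> N}"
    then have "($) k \<in> UNIV \<rightarrow>\<^sub>E {..N}"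
      using nth_le_vsum[of k] by (auto simp: PiE_iff intro: order_trans)
    then show "k \<in> vec_lambda ` (UNIV \<rightarrow>\<^sub>E {..N})"
      by (metis image_eqI vec_nth_inverse)
  qed
qed (simp add: finite_PiE)

section \<open>Products and derivatives of Jacobi weights\<close>

lemma jacobi_weight_split:
  "jacobi_weight a c y = (\<Prod>j\<in>UNIV - {i}. (y $ j) powr (a $ j)) * (y $ i) powr (a $ i) * (1 - vsum y) powr c"
  unfolding jacobi_weight_def by (subst prod.remove[of _ i]) (auto simp: mult_ac)

lemma jacobi_weight_mult:
  "jacobi_weight a c x * jacobi_weight b d x = jacobi_weight (a + b) (c + d) x"
  by (simp add: jacobi_weight_def powr_add prod.distrib mult_ac)

lemma jacobi_weight_nz:
  "x \<in> interior unit_simplex \<Longrightarrow> jacobi_weight a c x \<noteq> 0"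
  by (auto simp: interior_unit_simplex jacobi_weight_def less_le)

lemma monomial_fun_jacobi_weight:
  "x \<in> interior unit_simplex \<Longrightarrow> monomial_fun k x = jacobi_weight (real_vec k) 0 x"
  by (auto simp: interior_unit_simplex monomial_fun_def jacobi_weight_def powr_realpow)

text \<open>Only \<open>x_i\<close> and \<open>1 - |x|\<close> vary along the line, so the product
  rule has two terms. The exponent \<open>a + axis i 1\<close> makes this the operator
  \<open>\<partial>_i x_i\<close>, with the same two coefficients as in
  \<open>dirichlet_const_recurrence\<close>.\<close>

lemma has_derivative_jacobi_weight:
  assumes "x \<in> interior (unit_simplex :: (real ^ 'd::finite) set)"
  shows "((\<lambda>t. jacobi_weight (a + axis i 1) c (x + t *\<^sub>R axis i 1)) has_real_derivative
    (a $ i + 1) * jacobi_weight a c x - c * jacobi_weight (a + axis i 1) (c - 1) x) (at 0)"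
proof -
  define P where "P = (\<Prod>j\<in>UNIV - {i}. (x $ j) powr (a $ j))"
  have x: "0 < x $ i" "vsum x < 1"
    using assms by (auto simp: interior_unit_simplex)
  have "(\<Prod>j\<in>UNIV - {i}. ((x + t *\<^sub>R axis i 1) $ j) powr ((a + axis i 1) $ j)) = P" for t
    unfolding P_def by (intro prod.cong) (auto simp: axis_component)
  then have "jacobi_weight (a + axis i 1) c (x + t *\<^sub>R axis i 1)
      = P * (x $ i + t) powr (a $ i + 1) * (1 - vsum x - t) powr c" for t
    by (subst jacobi_weight_split[of _ _ _ i]) (auto simp: vsum_add vsum_scaleR axis_component algebra_simps)
  moreover have "((\<lambda>t. P * (x $ i + t) powr (a $ i + 1) * (1 - vsum x - t) powr c) has_real_derivative
      P * ((a $ i + 1) * (x $ i) powr (a $ i)) * (1 - vsum x) powr c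
      - P * (x $ i) powr (a $ i + 1) * (c * (1 - vsum x) powr (c - 1))) (at 0)"
  proof -
    have "((\<lambda>t. (x $ i + t) powr (a $ i + 1)) has_real_derivative (a $ i + 1) * (x $ i) powr (a $ i)) (at 0)"
      using DERIV_fun_powr[of "\<lambda>t. x $ i + t" 1 0 "a $ i + 1"] x
      by (auto intro!: derivative_eq_intros)
    moreover have "((\<lambda>t. (1 - vsum x - t) powr c) has_real_derivative - (c * (1 - vsum x) powr (c - 1))) (at 0)"
      using DERIV_fun_powr[of "\<lambda>t. 1 - vsum x - t" "-1" 0 c] x
      by (auto intro!: derivative_eq_intros)
    ultimately show ?thesis
      by (rule DERIV_mult[OF DERIV_cmult, THEN DERIV_cong]) simp
  qed
  moreover have "jacobi_weight a c x = P * (x $ i) powr (a $ i) * (1 - vsum x) powr c"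
    unfolding P_def by (rule jacobi_weight_split)
  moreover have "jacobi_weight (a + axis i 1) (c - 1) x = P * (x $ i) powr (a $ i + 1) * (1 - vsum x) powr (c - 1)"
    unfolding P_def by (subst jacobi_weight_split[of _ _ _ i]) (auto simp: axis_component intro!: prod.cong)
  ultimately show ?thesis
    by (simp add: mult_ac)
qed

text \<open>The operator \<open>x\<^sub>i \<partial>\<^sub>i + s\<close> on the span of the functions
  \<open>(-1)\<^bsup>|k|\<^esup> x\<^sup>k (1 - |x|)\<^bsup>c - |k|\<^esup>\<close>, in terms of coefficients.\<close>

definition euler_coeff :: "real \<Rightarrow> 'd \<Rightarrow> real \<Rightarrow> (nat ^ 'd::finite \<Rightarrow> real) \<Rightarrow> nat ^ 'd \<Rightarrow> real" where
  "euler_coeff c i s q k = (real (k $ i) + s) * q k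
    + (if k $ i = 0 then 0 else (c - real (vsum k) + 1) * q (k - axis i 1))"

text \<open>The head of the list acts last.\<close>

definition euler_coeffs :: "real \<Rightarrow> ('d \<times> real) list \<Rightarrow> (nat ^ 'd::finite \<Rightarrow> real) \<Rightarrow> nat ^ 'd \<Rightarrow> real" where
  "euler_coeffs c = foldr (\<lambda>(i, s). euler_coeff c i s)"

lemma euler_coeffs_simps [simp]:
  "euler_coeffs c [] q = q"
  "euler_coeffs c ((i, s) # L) q = euler_coeff c i s (euler_coeffs c L q)"
  "euler_coeffs c (L @ L') q = euler_coeffs c L (euler_coeffs c L' q)"
  by (auto simp: euler_coeffs_def)

text \<open>For \<open>i = j\<close> the two operators differ by a constant multiple of the
  identity. For different indices, lowering \<open>k_i\<close> leaves \<open>k_j\<close> alone, and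
  the remaining factors depend on |k| only, which drops by one either way.\<close>

lemma euler_coeff_commute:
  "euler_coeff c i s (euler_coeff c j t q) = euler_coeff c j t (euler_coeff c i s q)"
proof
  fix k
  show "euler_coeff c i s (euler_coeff c j t q) k = euler_coeff c j t (euler_coeff c i s q) k"
  proof (cases "i = j")
    case True
    have "real ((k - axis j 1) $ j) = real (k $ j) - 1" if "k $ j \<noteq> 0"
      using that by (simp add: axis_component of_nat_diff)
    then show ?thesis
      unfolding True by (cases "k $ j = 0") (simp_all add: euler_coeff_def algebra_simps)
  next
    case False
    have "k - axis i 1 - axis j 1 = k - axis j 1 - axis i 1"
      by (simp add: vec_eq_iff add.commute)
    moreover have "(axis i 1 :: nat ^ 'a) $ j = 0" "(axis j 1 :: nat ^ 'a) $ i = 0"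
      using False by (auto simp: axis_component)
    moreover have "real (vsum (k - axis l 1)) = real (vsum k) - 1" if "k $ l > 0" for l
      using vsum_diff_axis[OF that] by simp
    moreover have "vsum (k - axis i 1) = vsum (k - axis j 1)" if "k $ i > 0" "k $ j > 0"
      using vsum_diff_axis[OF that(1)] vsum_diff_axis[OF that(2)] by simp
    ultimately show ?thesis
      by (auto simp: euler_coeff_def algebra_simps simp del: One_nat_def)
  qed
qed

text \<open>By commutativity any listed factor can be moved to the front, where it acts last. The
  length of the rest is recorded because it bounds the support of the coefficients to which that
  factor is applied.\<close>

lemma euler_coeffs_extract:
  assumes "(i, s) \<in> set L"
  obtains L' where "length L = Suc (length L')" "\<And>q. euler_coeffs c L q = euler_coeff c i s (euler_coeffs c L' q)"
proof -
  have "\<exists>L'. length L = Suc (length L') \<and> (\<forall>q. euler_coeffs c L q = euler_coeff c i s (euler_coeffs c L' q))"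
    using assms
  proof (induction L)
    case (Cons p L)
    show ?case
    proof (cases "p = (i, s)")
      case True
      then show ?thesis by (intro exI[of _ L]) auto
    next
      case False
      with Cons obtain L' where "length L = Suc (length L')"
        "\<And>q. euler_coeffs c L q = euler_coeff c i s (euler_coeffs c L' q)" by auto
      then show ?thesis
        by (intro exI[of _ "p # L'"]) (cases p, auto simp: euler_coeff_commute)
    qed
  qed auto
  then show ?thesis using that by blast
qed

text \<open>The new coefficient at k draws only on the old ones at k and
  \<open>k - axis i 1\<close>, so one factor raises the bound by at most one.\<close>

lemma euler_coeff_support:
  assumes "\<And>k. q k \<noteq> 0 \<Longrightarrow> vsum k \<le> r" "euler_coeff c i s q k \<noteq> 0"
  shows "vsum k \<le> Suc r"
proof (cases "q k = 0")
  case True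
  with assms(2) have "k $ i > 0" "q (k - axis i 1) \<noteq> 0"
    by (auto simp: euler_coeff_def split: if_splits)
  then show ?thesis
    using assms(1) vsum_diff_axis by (metis Suc_le_mono)
qed (use assms(1) le_SucI in blast)

lemma euler_coeffs_support:
  assumes "\<And>k. q k \<noteq> 0 \<Longrightarrow> vsum k \<le> r" "euler_coeffs c L q k \<noteq> 0"
  shows "vsum k \<le> length L + r"
  using assms(2)
proof (induction L arbitrary: k)
  case (Cons p L)
  then show ?case
    using euler_coeff_support[of "euler_coeffs c L q" "length L + r" c "fst p" "snd p" k]
    by (cases p) auto
qed (use assms(1) in auto)

text \<open>Summation by parts: the shift is moved from q to G, and the sign \<open>(-1)^|k|\<close>
  turns the plus of \<open>euler_coeff\<close> into a minus. G is arbitrary because it stands for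
  the weights when differentiating and for their Dirichlet integrals when integrating.\<close>

lemma sum_euler_coeff:
  fixes q :: "nat ^ 'd::finite \<Rightarrow> real"
  assumes "\<And>k. q k \<noteq> 0 \<Longrightarrow> vsum k < N"
  shows "(\<Sum>k | vsum k \<le> N. (-1) ^ vsum k * euler_coeff c i s q k * G k)
    = (\<Sum>k | vsum k \<le> N. (-1) ^ vsum k * q k * ((real (k $ i) + s) * G k - (c - real (vsum k)) * G (k + axis i 1)))"
proof -
  let ?K = "{k :: nat ^ 'd. vsum k \<le> N}"
  have "(\<Sum>k\<in>?K. (-1) ^ vsum k * (if k $ i = 0 then 0 else (c - real (vsum k) + 1) * q (k - axis i 1)) * G k)
    = (\<Sum>k | vsum k \<le> N \<and> k $ i \<noteq> 0. (-1) ^ vsum k * ((c - real (vsum k) + 1) * q (k - axis i 1)) * G k)"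
    by (rule sum.mono_neutral_cong_right) auto
  also have "\<dots> = (\<Sum>k | Suc (vsum k) \<le> N. - ((-1) ^ vsum k * ((c - real (vsum k)) * q k) * G (k + axis i 1)))"
  proof (rule sum.reindex_bij_witness[of _ "\<lambda>k. k + axis i 1" "\<lambda>k. k - axis i 1"])
    fix k :: "nat ^ 'd" assume k: "k \<in> {k. vsum k \<le> N \<and> k $ i \<noteq> 0}"
    then show *: "k - axis i 1 + axis i 1 = k"
      by (auto simp: vec_eq_iff axis_component)
    show "k - axis i 1 \<in> {k. Suc (vsum k) \<le> N}"
      using k vsum_diff_axis[of k i] by auto
    show "- ((-1) ^ vsum (k - axis i 1) * ((c - real (vsum (k - axis i 1))) * q (k - axis i 1))
        * G (k - axis i 1 + axis i 1))
      = (-1) ^ vsum k * ((c - real (vsum k) + 1) * q (k - axis i 1)) * G k"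
      using k vsum_diff_axis[of k i] unfolding * by (simp add: algebra_simps)
  next
    fix k :: "nat ^ 'd" assume k: "k \<in> {k. Suc (vsum k) \<le> N}"
    show "k + axis i 1 - axis i 1 = k"
      by (simp add: vec_eq_iff)
    show "k + axis i 1 \<in> {k. vsum k \<le> N \<and> k $ i \<noteq> 0}"
      using k by (simp add: vsum_add axis_component)
  qed
  \<comment> \<open>The range may grow to \<open>|k| \<le> N\<close> because q vanishes where
    \<open>|k| = N\<close>.\<close>
  also have "\<dots> = (\<Sum>k\<in>?K. - ((-1) ^ vsum k * ((c - real (vsum k)) * q k) * G (k + axis i 1)))"
    using assms by (intro sum.mono_neutral_left) (auto simp: Suc_le_eq)
  finally show ?thesis
    by (simp add: euler_coeff_def algebra_simps sum.distrib sum_subtractf sum_negf)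
qed

section \<open>Functions given by their coefficients, and their partial derivatives\<close>

definition euler_sum :: "nat \<Rightarrow> real ^ 'd \<Rightarrow> real \<Rightarrow> (nat ^ 'd::finite \<Rightarrow> real) \<Rightarrow> real ^ 'd \<Rightarrow> real" where
  "euler_sum N a c q x =
    (\<Sum>k | vsum k \<le> N. (-1) ^ vsum k * q k * jacobi_weight (a + real_vec k) (c - real (vsum k)) x)"

text \<open>A weight shifts the exponents of all terms alike and leaves the coefficients unchanged;
  this is what conjugation by a weight amounts to.\<close>

lemma jacobi_weight_euler_sum:
  "jacobi_weight b d x * euler_sum N a c q x = euler_sum N (b + a) (d + c) q x"
  unfolding euler_sum_def sum_distrib_left
  by (intro sum.cong refl)
    (simp add: mult.left_commute jacobi_weight_mult add.assoc diff_add_eq add_diff_eq)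

lemma partial_deriv_cong:
  assumes "\<And>y. y \<in> S \<Longrightarrow> f y = g y" "open S" "x \<in> S"
  shows "partial_deriv i f x = partial_deriv i g x"
  unfolding partial_deriv_def
proof (rule deriv_cong_ev)
  have "((\<lambda>t. x + t *\<^sub>R axis i 1) \<longlongrightarrow> x + 0 *\<^sub>R axis i 1) (at (0::real))"
    by (intro tendsto_intros)
  then have "eventually (\<lambda>t. x + t *\<^sub>R axis i 1 \<in> S) (at (0::real))"
    using assms by (auto dest: topological_tendstoD)
  then have "eventually (\<lambda>t. x + t *\<^sub>R axis i 1 \<in> S) (nhds (0::real))"
    using assms(3) by (simp add: eventually_nhds_conv_at)
  then show "eventually (\<lambda>t. f (x + t *\<^sub>R axis i 1) = g (x + t *\<^sub>R axis i 1)) (nhds (0::real))"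
    by eventually_elim (rule assms)
qed simp

text \<open>Termwise differentiation gives the right-hand side of \<open>sum_euler_coeff\<close>,
  with the weight of exponents \<open>a + k\<close> and \<open>c - |k|\<close> as G; moving the
  shift back to q yields one Euler factor.\<close>

lemma partial_deriv_euler_sum:
  assumes f: "\<And>x. x \<in> interior unit_simplex \<Longrightarrow> f x = euler_sum N (a + axis i 1) c q x"
    and q: "\<And>k. q k \<noteq> 0 \<Longrightarrow> vsum k < N"
    and x: "x \<in> interior unit_simplex"
  shows "partial_deriv i f x = euler_sum N a c (euler_coeff c i (a $ i + 1) q) x"
proof -
  have "((\<lambda>t. euler_sum N (a + axis i 1) c q (x + t *\<^sub>R axis i 1)) has_real_derivative
    (\<Sum>k | vsum k \<le> N. (-1) ^ vsum k * q k *
      (((a + real_vec k) $ i + 1) * jacobi_weight (a + real_vec k) (c - real (vsum k)) x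
       - (c - real (vsum k)) * jacobi_weight (a + real_vec k + axis i 1) (c - real (vsum k) - 1) x))) (at 0)"
    unfolding euler_sum_def
  proof (intro DERIV_sum DERIV_cmult)
    fix k :: "nat ^ 'a"
    show "((\<lambda>t. jacobi_weight (a + axis i 1 + real_vec k) (c - real (vsum k)) (x + t *\<^sub>R axis i 1)) has_real_derivative
      ((a + real_vec k) $ i + 1) * jacobi_weight (a + real_vec k) (c - real (vsum k)) x
       - (c - real (vsum k)) * jacobi_weight (a + real_vec k + axis i 1) (c - real (vsum k) - 1) x) (at 0)"
      using has_derivative_jacobi_weight[OF x, of "a + real_vec k" i "c - real (vsum k)"]
      by (simp only: add.commute add.left_commute)
  qed
  also have "(\<Sum>k | vsum k \<le> N. (-1) ^ vsum k * q k *
      (((a + real_vec k) $ i + 1) * jacobi_weight (a + real_vec k) (c - real (vsum k)) x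
       - (c - real (vsum k)) * jacobi_weight (a + real_vec k + axis i 1) (c - real (vsum k) - 1) x))
    = euler_sum N a c (euler_coeff c i (a $ i + 1) q) x"
    unfolding euler_sum_def
    by (subst sum_euler_coeff[OF q]) (simp_all add: real_vec_add_axis vsum_add add_ac diff_diff_eq del: One_nat_def)
  finally have "partial_deriv i (euler_sum N (a + axis i 1) c q) x = euler_sum N a c (euler_coeff c i (a $ i + 1) q) x"
    unfolding partial_deriv_def by (rule DERIV_imp_deriv)
  moreover have "partial_deriv i f x = partial_deriv i (euler_sum N (a + axis i 1) c q) x"
    using f x by (intro partial_deriv_cong[of "interior unit_simplex"]) auto
  ultimately show ?thesis by simp
qed

text \<open>Each derivative uses up one unit of the exponent of \<open>x_i\<close>: the first to act
  contributes the constant \<open>a_i + r\<close>, the last \<open>a_i + 1\<close>. The bound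
  \<open>r + R \<le> N\<close> keeps the support strictly below N before every derivative.\<close>

lemma funpow_partial_deriv_euler_sum:
  assumes "\<And>x. x \<in> interior unit_simplex \<Longrightarrow> f x = euler_sum N (a + axis i (real r)) c q x"
    and "\<And>k. q k \<noteq> 0 \<Longrightarrow> vsum k \<le> R" "r + R \<le> N"
    and "x \<in> interior unit_simplex"
  shows "(partial_deriv i ^^ r) f x
    = euler_sum N a c (euler_coeffs c (map (\<lambda>j. (i, a $ i + real j)) [1..<Suc r]) q) x"
  using assms
proof (induction r arbitrary: a x)
  case 0
  have "axis i 0 = (0 :: real ^ 'a)" by (simp add: vec_eq_iff axis_component)
  with 0 show ?case by simp
next
  case (Suc r)
  let ?a = "a + axis i 1"
  let ?L = "map (\<lambda>j. (i, ?a $ i + real j)) [1..<Suc r]"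
  have "a + axis i (real (Suc r)) = ?a + axis i (real r)"
    by (simp add: vec_eq_iff axis_component)
  note eq = this
  have IH: "(partial_deriv i ^^ r) f y = euler_sum N ?a c (euler_coeffs c ?L q) y"
    if "y \<in> interior unit_simplex" for y
    using Suc.prems(1)[unfolded eq] Suc.prems(2) _ that
    by (rule Suc.IH) (use Suc.prems(3) in auto)
  \<comment> \<open>The outermost derivative supplies the head; the constants obtained from the
    shifted exponent are those from \<open>a_i + 2\<close> on.\<close>
  have L: "(i, a $ i + 1) # ?L = map (\<lambda>j. (i, a $ i + real j)) [1..<Suc (Suc r)]"
  proof -
    have "[1..<Suc (Suc r)] = 1 # map Suc [1..<Suc r]"
      by (simp add: map_Suc_upt upt_conv_Cons del: upt_Suc)
    then show ?thesis by (simp add: add_ac del: upt_Suc)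
  qed
  have "vsum k < N" if "euler_coeffs c ?L q k \<noteq> 0" for k
    using euler_coeffs_support[OF Suc.prems(2) that] Suc.prems(3) by (simp del: upt_Suc)
  with IH Suc.prems(4) have "(partial_deriv i ^^ Suc r) f x
      = euler_sum N a c (euler_coeff c i (a $ i + 1) (euler_coeffs c ?L q)) x"
    by (auto intro!: partial_deriv_euler_sum)
  then show ?case
    unfolding L[symmetric] by (simp del: upt_Suc)
qed

section \<open>Rodrigues operators\<close>

definition rodrigues_factors :: "real ^ 'd \<Rightarrow> nat ^ 'd \<Rightarrow> 'd list \<Rightarrow> ('d \<times> real) list" where
  "rodrigues_factors a n js = concat (map (\<lambda>i. map (\<lambda>s. (i, a $ i + real s)) [1..<Suc (n $ i)]) js)"

lemma length_rodrigues_factors: "length (rodrigues_factors a n js) = (\<Sum>i\<leftarrow>js. n $ i)"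
  by (induction js) (simp_all add: rodrigues_factors_def del: upt_Suc)

lemma foldr_partial_deriv_euler_sum:
  fixes a :: "real ^ 'd::{finite,linorder}"
  assumes "\<And>x. x \<in> interior unit_simplex \<Longrightarrow>
      f x = euler_sum N (a + (\<chi> i. if i \<in> set js then real (n $ i) else 0)) c q x"
    and "distinct js"
    and "\<And>k. q k \<noteq> 0 \<Longrightarrow> vsum k \<le> R" "(\<Sum>i\<leftarrow>js. n $ i) + R \<le> N"
    and "x \<in> interior unit_simplex"
  shows "foldr (\<lambda>i. partial_deriv i ^^ (n $ i)) js f x
    = euler_sum N a c (euler_coeffs c (rodrigues_factors a n js) q) x"
  using assms
proof (induction js arbitrary: a x)
  case Nil
  have "a + (\<chi> i. 0) = a" by (simp add: vec_eq_iff)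
  with Nil show ?case by (simp add: rodrigues_factors_def)
next
  case (Cons i js)
  let ?a = "a + axis i (real (n $ i))"
  have shift: "a + (\<chi> j. if j \<in> set (i # js) then real (n $ j) else 0)
      = ?a + (\<chi> j. if j \<in> set js then real (n $ j) else 0)"
    using Cons.prems(2) by (auto simp: vec_eq_iff axis_component)
  \<comment> \<open>By distinctness i is not in \<open>js\<close>, so the shift in coordinate i does
    not affect the other constants.\<close>
  have factors: "rodrigues_factors ?a n js = rodrigues_factors a n js"
    using Cons.prems(2) unfolding rodrigues_factors_def
    by (intro arg_cong[of _ _ concat] map_cong) (auto simp: axis_component)
  have IH: "foldr (\<lambda>i. partial_deriv i ^^ (n $ i)) js f y
      = euler_sum N ?a c (euler_coeffs c (rodrigues_factors a n js) q) y"
    if "y \<in> interior unit_simplex" for y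
    unfolding factors[symmetric]
    using Cons.prems(1)[unfolded shift] _ Cons.prems(3) _ that
    by (rule Cons.IH) (use Cons.prems(2,4) in auto)
  have "(partial_deriv i ^^ (n $ i)) (foldr (\<lambda>i. partial_deriv i ^^ (n $ i)) js f) x
    = euler_sum N a c (euler_coeffs c (map (\<lambda>j. (i, a $ i + real j)) [1..<Suc (n $ i)])
        (euler_coeffs c (rodrigues_factors a n js) q)) x"
    using IH euler_coeffs_support[OF Cons.prems(3)] _ Cons.prems(5)
    by (rule funpow_partial_deriv_euler_sum) (use Cons.prems(4) in \<open>auto simp: length_rodrigues_factors\<close>)
  then show ?case
    by (simp add: rodrigues_factors_def del: upt_Suc)
qed

definition all_factors :: "real ^ 'd::{finite,linorder} \<Rightarrow> nat ^ 'd::{finite,linorder} \<Rightarrow> ('d \<times> real) list" where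
  "all_factors a n = rodrigues_factors a n (sorted_list_of_set UNIV)"

lemma length_all_factors [simp]: "length (all_factors a n) = vsum n"
  by (simp add: all_factors_def length_rodrigues_factors vsum_def sum_list_distinct_conv_sum_set)

lemma set_all_factors:
  "set (all_factors a n) = {(i, a $ i + real s) | i s. 1 \<le> s \<and> s \<le> n $ i}"
  unfolding all_factors_def rodrigues_factors_def by (force simp: less_Suc_eq_le simp del: upt_Suc)

text \<open>The weight under the derivatives raises the exponents to \<open>a + n\<close> and
  \<open>\<gamma> + N\<close>, the derivatives bring \<open>a + n\<close> down to a, and division by
  the weight restores the exponents 0 and N. The result has the form of the input, so the operators
  can be composed.\<close>

lemma rodrigues_op_euler_sum:
  fixes a :: "real ^ 'd::{finite,linorder}"
  assumes g: "\<And>x. x \<in> interior unit_simplex \<Longrightarrow> g x = euler_sum N 0 (real N) q x"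
    and q: "\<And>k. q k \<noteq> 0 \<Longrightarrow> vsum k \<le> R" "vsum n + R \<le> N"
    and x: "x \<in> interior unit_simplex"
  shows "rodrigues_op a \<gamma> n g x = euler_sum N 0 (real N) (euler_coeffs (\<gamma> + real N) (all_factors a n) q) x"
proof -
  let ?q = "euler_coeffs (\<gamma> + real N) (all_factors a n) q"
  have "mixed_partial n
      (\<lambda>y. (\<Prod>i\<in>UNIV. (y $ i) powr (real (n $ i) + a $ i)) * (1 - vsum y) powr \<gamma> * g y) x
    = euler_sum N a (\<gamma> + real N) ?q x"
    unfolding mixed_partial_def all_factors_def
  proof (rule foldr_partial_deriv_euler_sum[OF _ _ q(1) _ x])
    fix y :: "real ^ 'd::{finite,linorder}"
    assume y: "y \<in> interior unit_simplex"
    let ?b = "a + (\<chi> i. if i \<in> set (sorted_list_of_set UNIV) then real (n $ i) else 0)"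
    have "(\<Prod>i\<in>UNIV. (y $ i) powr (real (n $ i) + a $ i)) * (1 - vsum y) powr \<gamma> = jacobi_weight ?b \<gamma> y"
      by (simp add: jacobi_weight_def add.commute)
    then show "(\<Prod>i\<in>UNIV. (y $ i) powr (real (n $ i) + a $ i)) * (1 - vsum y) powr \<gamma> * g y
      = euler_sum N ?b (\<gamma> + real N) q y"
      using g[OF y] by (simp add: jacobi_weight_euler_sum)
  qed (use q(2) in \<open>auto simp: vsum_def sum_list_distinct_conv_sum_set\<close>)
  also have "\<dots> = jacobi_weight a \<gamma> x * euler_sum N 0 (real N) ?q x"
    by (simp add: jacobi_weight_euler_sum)
  finally show ?thesis
    using jacobi_weight_nz[OF x] by (simp add: rodrigues_op_def)
qed

section \<open>The coefficients of U\<close>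

definition coeff_one :: "nat ^ 'd \<Rightarrow> real" where
  "coeff_one k = (if k = 0 then 1 else 0)"

lemma coeff_one_support: "coeff_one k \<noteq> 0 \<Longrightarrow> vsum k \<le> 0"
  by (auto simp: coeff_one_def vsum_def split: if_splits)

text \<open>The function to which the operators are applied is the single term
  \<open>k = 0\<close>.\<close>

lemma euler_sum_coeff_one:
  assumes "x \<in> interior unit_simplex"
  shows "euler_sum N 0 (real N) coeff_one x = (1 - vsum x) ^ N"
proof -
  have x: "0 < x $ i" "vsum x < 1" for i
    using assms by (auto simp: interior_unit_simplex)
  have "euler_sum N 0 (real N) coeff_one x
    = (\<Sum>k\<in>{0}. (-1) ^ vsum k * coeff_one k *
        jacobi_weight (0 + real_vec k) (real N - real (vsum k)) x)"
    unfolding euler_sum_def by (rule sum.mono_neutral_right) (auto simp: coeff_one_def vsum_def[of "0 :: nat ^ 'a"])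
  also have "\<dots> = (1 - vsum x) ^ N"
    using x by (simp add: coeff_one_def vsum_def[of "0 :: nat ^ 'a"] jacobi_weight_def powr_realpow less_imp_neq[symmetric])
  finally show ?thesis .
qed

definition U_coeff :: "real ^ 'd::{finite,linorder} \<Rightarrow> real ^ 'd::{finite,linorder} \<Rightarrow> real \<Rightarrow>
    nat ^ 'd::{finite,linorder} \<Rightarrow> nat ^ 'd::{finite,linorder} \<Rightarrow> nat ^ 'd::{finite,linorder} \<Rightarrow> real" where
  "U_coeff \<alpha> \<beta> \<gamma> n m =
     euler_coeffs (\<gamma> + real (vsum n + vsum m)) (all_factors \<beta> m @ all_factors \<alpha> n) coeff_one"

lemma U_fun_euler_sum:
  assumes "x \<in> interior unit_simplex"
  shows "U_fun \<alpha> \<beta> \<gamma> n m x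
    = euler_sum (vsum n + vsum m) 0 (real (vsum n + vsum m)) (U_coeff \<alpha> \<beta> \<gamma> n m) x"
proof -
  let ?N = "vsum n + vsum m"
  have 1: "rodrigues_op \<alpha> \<gamma> n (\<lambda>x. (1 - vsum x) ^ ?N) y
    = euler_sum ?N 0 (real ?N) (euler_coeffs (\<gamma> + real ?N) (all_factors \<alpha> n) coeff_one) y"
    if "y \<in> interior unit_simplex" for y
    using euler_sum_coeff_one[symmetric] coeff_one_support _ that by (rule rodrigues_op_euler_sum) auto
  show ?thesis
    unfolding U_fun_def U_coeff_def comp_apply euler_coeffs_simps(3)
    \<comment> \<open>After \<open>D_1\<close> the support is bounded by |n|, which leaves room for
      |m| more derivatives. Knowing the first result on the interior suffices, as derivatives there
      are local.\<close>
    using 1 euler_coeffs_support[OF coeff_one_support] _ assms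
    by (rule rodrigues_op_euler_sum) auto
qed

section \<open>Positivity of the coefficients\<close>

lemma euler_coeff_nonneg:
  assumes "\<And>k. 0 \<le> q k" "\<And>k. q k \<noteq> 0 \<Longrightarrow> real (vsum k) < c" "s > 0"
  shows "0 \<le> euler_coeff c i s q k" "0 < q 0 \<Longrightarrow> 0 < euler_coeff c i s q 0"
proof -
  have "0 \<le> (c - real (vsum k) + 1) * q (k - axis i 1)" if "k $ i \<noteq> 0"
  proof (cases "q (k - axis i 1) = 0")
    case False
    \<comment> \<open>Since \<open>|k - axis i 1| = |k| - 1\<close>, this says that the factor
      \<open>c - |k| + 1\<close> is positive.\<close>
    then have "real (vsum (k - axis i 1)) < c" by (rule assms)
    then show ?thesis
      using assms(1)[of "k - axis i 1"] vsum_diff_axis[of k i] that by simp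
  qed simp
  then show "0 \<le> euler_coeff c i s q k"
    using assms(1)[of k] assms(3) by (auto simp: euler_coeff_def intro!: add_nonneg_nonneg)
  \<comment> \<open>At \<open>k = 0\<close> there is no shifted term, and q 0 is multiplied by
    s.\<close>
  show "0 < euler_coeff c i s q 0" if "0 < q 0"
    using that assms(3) by (simp add: euler_coeff_def)
qed

lemma euler_coeffs_coeff_one_nonneg:
  fixes L :: "('d::finite \<times> real) list"
  assumes "\<And>i s. (i, s) \<in> set L \<Longrightarrow> s > 0" "real (length L) < c + 1"
  shows "(\<forall>k. 0 \<le> euler_coeffs c L coeff_one k) \<and> 0 < euler_coeffs c L coeff_one 0"
  using assms(1,2)
proof (induction L)
  case (Cons p L)
  obtain i s where p: "p = (i, s)" by (cases p)
  have IH: "\<And>k. 0 \<le> euler_coeffs c L coeff_one k" "0 < euler_coeffs c L coeff_one 0"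
    using Cons by auto
  have "vsum k \<le> length L + 0" if "euler_coeffs c L coeff_one k \<noteq> 0" for k
    using coeff_one_support that by (rule euler_coeffs_support)
  \<comment> \<open>The tail is one shorter than the full list, whose length is below
    \<open>c + 1\<close>.\<close>
  then have "real (vsum k) < c" if "euler_coeffs c L coeff_one k \<noteq> 0" for k
    using that Cons.prems(2) by fastforce
  with IH show ?case
    using Cons.prems(1)[of i s] by (auto simp: p intro!: euler_coeff_nonneg)
qed (simp add: coeff_one_def)

lemma U_coeff_nonneg:
  fixes \<alpha> \<beta> :: "real ^ 'd::{finite,linorder}"
  assumes "\<And>i. \<alpha> $ i > -1" "\<And>i. \<beta> $ i > -1" "\<gamma> > -1"
  shows "0 \<le> U_coeff \<alpha> \<beta> \<gamma> n m k" "0 < U_coeff \<alpha> \<beta> \<gamma> n m 0"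
proof -
  have "a $ i + real s > 0" if "\<And>i. a $ i > -1" "1 \<le> s" for a :: "real ^ 'd::{finite,linorder}" and i s
    using that(1)[of i] that(2) by linarith
  then have pos: "s > 0" if "(i, s) \<in> set (all_factors \<beta> m @ all_factors \<alpha> n)" for i s
    using that assms(1,2) by (auto simp: set_all_factors)
  \<comment> \<open>There are |n| + |m| factors, so this bound is the condition
    \<open>\<gamma> > -1\<close>.\<close>
  have len: "real (length (all_factors \<beta> m @ all_factors \<alpha> n)) < \<gamma> + real (vsum n + vsum m) + 1"
    using assms(3) by simp
  show "0 \<le> U_coeff \<alpha> \<beta> \<gamma> n m k" "0 < U_coeff \<alpha> \<beta> \<gamma> n m 0"
    unfolding U_coeff_def using euler_coeffs_coeff_one_nonneg[OF pos len] by auto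
qed

section \<open>Vanishing integrals and orthogonality\<close>

lemma euler_sum_integral:
  fixes a :: "real ^ 'd::finite"
  assumes "\<And>i. a $ i > -1" "\<gamma> > -1"
  shows "euler_sum N a (\<gamma> + real N) q absolutely_integrable_on interior unit_simplex"
    and "(LINT x:interior unit_simplex|lebesgue. euler_sum N a (\<gamma> + real N) q x)
      = (\<Sum>k | vsum k \<le> N. (-1) ^ vsum k * q k *
          dirichlet_const (($) (a + real_vec k)) (\<gamma> + real N - real (vsum k)) UNIV)"
proof -
  \<comment> \<open>For \<open>|k| \<le> N\<close> the last exponent is at least \<gamma>, so every
    term is integrable.\<close>
  have *: "(a + real_vec k) $ i > -1" "\<gamma> + real N - real (vsum k) > -1" if "vsum k \<le> N" for i k
    using assms(1)[of i] assms(2) that by simp_all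
  have int: "set_integrable lebesgue (interior unit_simplex)
      (\<lambda>x. (-1) ^ vsum k * q k * jacobi_weight (a + real_vec k) (\<gamma> + real N - real (vsum k)) x)"
    if "vsum k \<le> N" for k
    using absolutely_integrable_jacobi_weight[OF *[OF that]]
    by (intro set_integrable_mult_right) auto
  show "euler_sum N a (\<gamma> + real N) q absolutely_integrable_on interior unit_simplex"
    unfolding euler_sum_def[abs_def] using int
    by (intro absolutely_integrable_sum) auto
  show "(LINT x:interior unit_simplex|lebesgue. euler_sum N a (\<gamma> + real N) q x)
      = (\<Sum>k | vsum k \<le> N. (-1) ^ vsum k * q k *
          dirichlet_const (($) (a + real_vec k)) (\<gamma> + real N - real (vsum k)) UNIV)"
  proof -
    have "(LINT x:interior unit_simplex|lebesgue. euler_sum N a (\<gamma> + real N) q x)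
      = (\<Sum>k | vsum k \<le> N. LINT x:interior unit_simplex|lebesgue.
          (-1) ^ vsum k * q k * jacobi_weight (a + real_vec k) (\<gamma> + real N - real (vsum k)) x)"
      unfolding euler_sum_def set_lebesgue_integral_def scaleR_sum_right
      using int by (intro Bochner_Integration.integral_sum) (auto simp: set_integrable_def)
    then show ?thesis
      using * by (simp add: integral_jacobi_weight)
  qed
qed

text \<open>With the constant \<open>a_i + 1\<close> the factor is the exact derivative
  \<open>\<partial>_i x_i\<close>. Summation by parts, with the Dirichlet integrals as G, makes
  every bracket an instance of \<open>dirichlet_const_recurrence\<close>.\<close>

lemma integral_euler_sum_eq_0:
  fixes a :: "real ^ 'd::finite"
  assumes a: "\<And>i. a $ i > -1" "\<gamma> > -1"
    and q: "\<And>k. q k \<noteq> 0 \<Longrightarrow> vsum k < N"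
  shows "(LINT x:interior unit_simplex|lebesgue.
      euler_sum N a (\<gamma> + real N) (euler_coeff (\<gamma> + real N) i (a $ i + 1) q) x) = 0"
proof -
  let ?c = "\<gamma> + real N"
  let ?D = "\<lambda>k. dirichlet_const (($) (a + real_vec k)) (?c - real (vsum k)) UNIV"
  have "q k * ((real (k $ i) + (a $ i + 1)) * ?D k - (?c - real (vsum k)) * ?D (k + axis i 1)) = 0" for k
  proof (cases "q k = 0")
    case False
    then have k: "vsum k < N" by (rule q)
    have pos: "(a + real_vec k) $ j > -1" for j
      using a(1)[of j] by simp
    \<comment> \<open>Here \<open>|k| < N\<close> is needed strictly:
      \<open>\<gamma> + N - |k|\<close> is then at least \<open>\<gamma> + 1\<close>.\<close>
    have c: "?c - real (vsum k) > 0"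
      using a(2) k by linarith
    have "?D (k + axis i 1) = dirichlet_const (($) (a + real_vec k + axis i 1)) (?c - real (vsum k) - 1) UNIV"
      by (simp add: real_vec_add_axis vsum_add add.assoc diff_diff_eq add_ac del: One_nat_def)
    then show ?thesis
      using dirichlet_const_recurrence[OF pos c, of i] by (simp add: add_ac)
  qed simp
  then show ?thesis
    unfolding euler_sum_integral(2)[OF a]
    by (subst sum_euler_coeff[OF q]) (simp_all only: mult.assoc mult_zero_right sum.neutral_const not_False_eq_True)
qed

text \<open>Multiplying by \<open>x^l\<close> and the weight shifts the exponents to
  \<open>a + l\<close>. The assumed factor has the constant \<open>(a + l)_i + 1\<close>, which for
  these exponents is an exact derivative. Both orthogonality relations are instances, since
  \<open>a\<close> is independent of the order of the two operators.\<close>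

lemma U_fun_orthogonal:
  fixes \<alpha> \<beta> a :: "real ^ 'd::{finite,linorder}"
  assumes a: "\<And>i. a $ i > -1" "\<gamma> > -1"
    and factor: "(i, a $ i + real (l $ i) + 1) \<in> set (all_factors \<beta> m @ all_factors \<alpha> n)"
  shows "(\<lambda>x. U_fun \<alpha> \<beta> \<gamma> n m x * monomial_fun l x * jacobi_weight a \<gamma> x)
         absolutely_integrable_on unit_simplex \<and>
       (LINT x:unit_simplex|lebesgue.
          U_fun \<alpha> \<beta> \<gamma> n m x * monomial_fun l x * jacobi_weight a \<gamma> x) = 0"
proof -
  let ?N = "vsum n + vsum m" and ?S = "interior unit_simplex :: (real ^ 'd::{finite,linorder}) set"
  let ?c = "\<gamma> + real ?N" and ?b = "a + real_vec l"
  let ?f = "\<lambda>x. U_fun \<alpha> \<beta> \<gamma> n m x * monomial_fun l x * jacobi_weight a \<gamma> x"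
  let ?g = "euler_sum ?N ?b ?c (U_coeff \<alpha> \<beta> \<gamma> n m)"
  have b: "?b $ j > -1" for j
    using a(1)[of j] by simp
  have fg: "?f x = ?g x" if "x \<in> ?S" for x
  proof -
    have "?f x = jacobi_weight a \<gamma> x * (jacobi_weight (real_vec l) 0 x * U_fun \<alpha> \<beta> \<gamma> n m x)"
      using monomial_fun_jacobi_weight[OF that] by (simp add: mult_ac)
    then show ?thesis
      unfolding U_fun_euler_sum[OF that] jacobi_weight_euler_sum by simp
  qed
  obtain L where L: "length (all_factors \<beta> m @ all_factors \<alpha> n) = Suc (length L)"
      "\<And>q. euler_coeffs ?c (all_factors \<beta> m @ all_factors \<alpha> n) q
         = euler_coeff ?c i (?b $ i + 1) (euler_coeffs ?c L q)"
    using euler_coeffs_extract[OF factor] by (metis real_vec_nth vector_add_component)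
  \<comment> \<open>Removing the extracted factor leaves N - 1 factors.\<close>
  have "vsum k < ?N" if "euler_coeffs ?c L coeff_one k \<noteq> 0" for k
    using euler_coeffs_support[OF coeff_one_support that] L(1) by simp
  then have zero: "(LINT x:?S|lebesgue. ?g x) = 0"
    unfolding U_coeff_def L(2) by (rule integral_euler_sum_eq_0[OF b a(2)])
  have gS: "?g absolutely_integrable_on ?S"
    by (rule euler_sum_integral[OF b a(2)])
  \<comment> \<open>The formula for U is available on the interior only; the rest of the simplex is
    null.\<close>
  have neg: "negligible (unit_simplex - ?S)"
    by (rule negligible_unit_simplex_boundary)
  have sub: "?S \<subseteq> unit_simplex"
    by (rule interior_subset)
  have "?f absolutely_integrable_on ?S"
    using gS by (rule absolutely_integrable_spike[of _ _ "{}"]) (use fg in auto)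
  then have fT: "?f absolutely_integrable_on unit_simplex"
    by (rule absolutely_integrable_spike_set) (use sub in \<open>auto intro: negligible_subset[OF neg]\<close>)
  have "(LINT x:unit_simplex|lebesgue. ?f x) = integral unit_simplex ?f"
    using fT by (rule set_lebesgue_integral_eq_integral)
  also have "\<dots> = integral ?S ?f"
    by (rule integral_spike_set) (use sub in \<open>auto intro: negligible_subset[OF neg]\<close>)
  also have "\<dots> = integral ?S ?g"
    using fg by (intro integral_cong) auto
  also have "\<dots> = 0"
    using zero set_lebesgue_integral_eq_integral(2)[OF gS] by simp
  finally show ?thesis using fT by simp
qed

section \<open>Total degree\<close>

text \<open>Only an upper bound on the degree, so that sums stay in the class even when leading
  terms cancel.\<close>

definition poly_fun_le :: "nat \<Rightarrow> (real ^ 'd::finite \<Rightarrow> real) \<Rightarrow> bool" where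
  "poly_fun_le N f \<longleftrightarrow> (\<exists>p. (\<forall>k\<in>Poly_Mapping.keys p. vsum k \<le> N) \<and> f = mpoly_eval p)"

lemma mpoly_eval_superset:
  assumes "finite K" "Poly_Mapping.keys p \<subseteq> K"
  shows "mpoly_eval p x = (\<Sum>k\<in>K. Poly_Mapping.lookup p k * monomial_fun k x)"
  unfolding mpoly_eval_def using assms
  by (intro sum.mono_neutral_left) (auto simp: in_keys_iff)

lemma mpoly_eval_add: "mpoly_eval (p + q) x = mpoly_eval p x + mpoly_eval q x"
proof -
  let ?K = "Poly_Mapping.keys p \<union> Poly_Mapping.keys q"
  have "finite ?K" by simp
  note * = mpoly_eval_superset[OF this]
  show ?thesis
    using Poly_Mapping.keys_add[of p q]
    by (simp add: *[of p] *[of q] *[of "p + q"] lookup_add ring_distribs sum.distrib)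
qed

lemma poly_fun_le_monomial: "vsum k \<le> N \<Longrightarrow> poly_fun_le N (\<lambda>x. c * monomial_fun k x)"
  unfolding poly_fun_le_def
proof (intro exI[of _ "Poly_Mapping.single k c"] conjI ext)
  show "c * monomial_fun k x = mpoly_eval (Poly_Mapping.single k c) x" for x
    by (subst mpoly_eval_superset[of "{k}"]) auto
qed (auto split: if_splits)

lemma poly_fun_le_add:
  assumes "poly_fun_le N f" "poly_fun_le N g"
  shows "poly_fun_le N (\<lambda>x. f x + g x)"
proof -
  obtain p q where "\<forall>k\<in>Poly_Mapping.keys p. vsum k \<le> N" "f = mpoly_eval p"
    "\<forall>k\<in>Poly_Mapping.keys q. vsum k \<le> N" "g = mpoly_eval q"
    using assms unfolding poly_fun_le_def by blast
  then show ?thesis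
    unfolding poly_fun_le_def using Poly_Mapping.keys_add[of p q]
    by (intro exI[of _ "p + q"]) (auto simp: mpoly_eval_add)
qed

lemma poly_fun_le_sum:
  "(\<And>i. i \<in> I \<Longrightarrow> poly_fun_le N (f i)) \<Longrightarrow> poly_fun_le N (\<lambda>x. \<Sum>i\<in>I. f i x)"
proof (induction I rule: infinite_finite_induct)
  case (insert i I)
  then show ?case by (simp add: poly_fun_le_add)
\<comment> \<open>Empty and infinite sums are the zero function, written as 0 times the constant
  monomial.\<close>
qed (use poly_fun_le_monomial[of 0 N 0] in \<open>auto simp: vsum_def[of 0]\<close>)

lemma monomial_fun_add: "monomial_fun (k + l) x = monomial_fun k x * monomial_fun l x"
  by (simp add: monomial_fun_def power_add prod.distrib)

lemma monomial_fun_axis: "monomial_fun (axis i 1) x = x $ i"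
  unfolding monomial_fun_def by (subst prod.remove[of _ i]) (auto simp: axis_component)

text \<open>Expanding one factor \<open>1 - |x|\<close> into 1 minus the sum of the
  \<open>x_i\<close> trades a unit of e for at most a unit of |k|.\<close>

lemma poly_fun_le_monomial_power:
  "vsum k + e \<le> N \<Longrightarrow> poly_fun_le N (\<lambda>x. c * (monomial_fun k x * (1 - vsum x) ^ e))"
proof (induction e arbitrary: k c)
  case 0
  then show ?case using poly_fun_le_monomial[of k N c] by simp
next
  case (Suc e)
  have "c * (monomial_fun k x * (1 - vsum x) ^ Suc e) = c * (monomial_fun k x * (1 - vsum x) ^ e)
      + (\<Sum>i\<in>UNIV. (- c) * (monomial_fun (k + axis i 1) x * (1 - vsum x) ^ e))" for x
    unfolding monomial_fun_add monomial_fun_axis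
    by (simp add: vsum_def[of x] sum_distrib_left sum_distrib_right sum_negf algebra_simps)
  moreover have "poly_fun_le N (\<lambda>x. c * (monomial_fun k x * (1 - vsum x) ^ e)
      + (\<Sum>i\<in>UNIV. (- c) * (monomial_fun (k + axis i 1) x * (1 - vsum x) ^ e)))"
    using Suc.prems by (intro poly_fun_le_add poly_fun_le_sum Suc.IH) (simp_all add: vsum_add del: One_nat_def)
  ultimately show ?case by presburger
qed

lemma monomial_fun_diagonal: "monomial_fun k (\<chi> i. t) = t ^ vsum k"
  by (simp add: monomial_fun_def vsum_def power_sum)

text \<open>The exact degree is read off on the diagonal, where all terms of the leading form have the
  same sign.\<close>

lemma has_total_degree_diagonal:
  fixes p :: "'d::finite mpolynomial"
  assumes le: "\<And>k. k \<in> Poly_Mapping.keys p \<Longrightarrow> vsum k \<le> N"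
    and P: "\<And>t. mpoly_eval p (\<chi> i. t) = poly P t" "coeff P N \<noteq> 0"
  shows "has_total_degree p N"
proof -
  let ?Q = "\<Sum>k\<in>Poly_Mapping.keys p. monom (Poly_Mapping.lookup p k) (vsum k)"
  have "poly P = poly ?Q"
    using P(1) by (auto simp: mpoly_eval_def monomial_fun_diagonal poly_sum poly_monom)
  then have "coeff ?Q N \<noteq> 0"
    using P(2) by (simp add: poly_eq_poly_eq_iff)
  then obtain k where "k \<in> Poly_Mapping.keys p" "vsum k = N"
    by (auto simp: coeff_sum elim!: sum.not_neutral_contains_not_neutral split: if_splits)
  then show ?thesis
    unfolding has_total_degree_def using le by (auto intro!: Max_eqI)
qed

lemma coeff_linear_power_top: "coeff ([:b, c:] ^ e) e = (c :: 'a::comm_ring_1) ^ e"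
proof (induction e)
  case (Suc e)
  have "degree ([:b, c:] ^ e) \<le> e"
    using degree_power_le[of "[:b, c:]" e] by (auto intro: order_trans split: if_splits)
  then show ?case
    using Suc by (simp add: coeff_eq_0)
qed simp

text \<open>On the diagonal the coefficient of \<open>t^N\<close> is \<open>(-1)^N\<close> times the
  sum of the \<open>u_k d^(N - |k|)\<close>, where \<open>u_k \<ge> 0\<close> and
  \<open>u_0 > 0\<close>; hence the degree does not drop.\<close>

lemma U_fun_polynomial:
  fixes \<alpha> \<beta> :: "real ^ 'd::{finite,linorder}"
  assumes "\<And>i. \<alpha> $ i > -1" "\<And>i. \<beta> $ i > -1" "\<gamma> > -1"
  shows "is_polynomial_of_degree_on (interior unit_simplex) (U_fun \<alpha> \<beta> \<gamma> n m) (vsum n + vsum m)"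
proof -
  let ?N = "vsum n + vsum m" and ?u = "U_coeff \<alpha> \<beta> \<gamma> n m"
  let ?K = "{k :: nat ^ 'd::{finite,linorder}. vsum k \<le> ?N}" and ?d = "real CARD('d)"
  \<comment> \<open>Since \<open>1 - |x|\<close> is positive inside the simplex, \<open>powr\<close>
    may be replaced by natural powers; F then makes sense everywhere, in particular on the whole
    diagonal.\<close>
  define F where "F = (\<lambda>x :: real ^ 'd::{finite,linorder}. \<Sum>k\<in>?K. (-1) ^ vsum k * ?u k * (monomial_fun k x * (1 - vsum x) ^ (?N - vsum k)))"
  have U: "U_fun \<alpha> \<beta> \<gamma> n m x = F x" if x: "x \<in> interior unit_simplex" for x
  proof -
    have "vsum x < 1" using x by (simp add: interior_unit_simplex)
    then have "jacobi_weight (0 + real_vec k) (real ?N - real (vsum k)) x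
        = monomial_fun k x * (1 - vsum x) ^ (?N - vsum k)" if "vsum k \<le> ?N" for k
      using monomial_fun_jacobi_weight[OF x, of k] that
      by (simp add: jacobi_weight_def powr_realpow flip: of_nat_diff of_nat_add)
    then show ?thesis
      unfolding U_fun_euler_sum[OF x] euler_sum_def F_def by (intro sum.cong) auto
  qed
  have "poly_fun_le ?N F"
    unfolding F_def by (intro poly_fun_le_sum poly_fun_le_monomial_power) auto
  then obtain p where p: "\<forall>k\<in>Poly_Mapping.keys p. vsum k \<le> ?N" "F = mpoly_eval p"
    unfolding poly_fun_le_def by blast
  \<comment> \<open>F at the point with all coordinates t, where \<open>|x| = d t\<close>.\<close>
  define P where "P = (\<Sum>k\<in>?K. smult ((-1) ^ vsum k * ?u k) (monom 1 (vsum k) * [:1, - ?d:] ^ (?N - vsum k)))"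
  have "F (\<chi> i. t) = poly P t" for t
    unfolding F_def P_def by (simp add: poly_sum monomial_fun_diagonal poly_monom vsum_def[of "\<chi> i. t"] mult_ac)
  moreover have "coeff P ?N \<noteq> 0"
  proof -
    have "coeff P ?N = (\<Sum>k\<in>?K. (-1) ^ ?N * (?u k * ?d ^ (?N - vsum k)))"
      unfolding P_def coeff_sum
    proof (intro sum.cong refl)
      fix k assume k: "k \<in> ?K"
      have "(-1 :: real) ^ ?N = (-1) ^ vsum k * (-1) ^ (?N - vsum k)"
        using k by (simp flip: power_add)
      moreover have "(- ?d) ^ (?N - vsum k) = (-1) ^ (?N - vsum k) * ?d ^ (?N - vsum k)"
        by (rule power_minus)
      ultimately show "coeff (smult ((-1) ^ vsum k * ?u k) (monom 1 (vsum k) * [:1, - ?d:] ^ (?N - vsum k))) ?N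
          = (-1) ^ ?N * (?u k * ?d ^ (?N - vsum k))"
        using k by (simp add: coeff_monom_mult coeff_linear_power_top)
    qed
    also have "\<dots> = (-1) ^ ?N * (\<Sum>k\<in>?K. ?u k * ?d ^ (?N - vsum k))"
      by (simp add: sum_distrib_left)
    finally have "coeff P ?N = \<dots>" .
    moreover have "0 < (\<Sum>k\<in>?K. ?u k * ?d ^ (?N - vsum k))"
    proof (rule sum_pos2[where i = 0])
      show "0 \<in> ?K" by (simp add: vsum_def[of 0])
      show "0 < ?u 0 * ?d ^ (?N - vsum 0)"
        using U_coeff_nonneg(2)[OF assms] by simp
      show "0 \<le> ?u k * ?d ^ (?N - vsum k)" for k
        using U_coeff_nonneg(1)[OF assms] by simp
    qed simp
    ultimately show ?thesis by simp
  qed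
  ultimately have "has_total_degree p ?N"
    using p by (intro has_total_degree_diagonal) auto
  then show ?thesis
    unfolding is_polynomial_of_degree_on_def using U p(2) by auto
qed

theorem proposition3p10:
  fixes \<alpha> \<beta> :: "real ^ 'd::{finite,linorder}" and \<gamma> :: real and n m :: "nat ^ 'd::{finite,linorder}"
  assumes "CARD('d) \<ge> 2"
    and "\<alpha> \<noteq> \<beta>"
    and "\<And>i. \<alpha> $ i > -1" and "\<And>i. \<beta> $ i > -1" and "\<gamma> > -1"
  shows "is_polynomial_of_degree_on (interior unit_simplex) (U_fun \<alpha> \<beta> \<gamma> n m) (vsum n + vsum m) \<and>
    (\<forall>l. (\<exists>i. l $ i < n $ i) \<longrightarrow>
       (\<lambda>x. U_fun \<alpha> \<beta> \<gamma> n m x * monomial_fun l x * jacobi_weight \<alpha> \<gamma> x)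
         absolutely_integrable_on unit_simplex \<and>
       (LINT x:unit_simplex|lebesgue.
          U_fun \<alpha> \<beta> \<gamma> n m x * monomial_fun l x * jacobi_weight \<alpha> \<gamma> x) = 0) \<and>
    (\<forall>l. (\<exists>i. l $ i < m $ i) \<longrightarrow>
       (\<lambda>x. U_fun \<alpha> \<beta> \<gamma> n m x * monomial_fun l x * jacobi_weight \<beta> \<gamma> x)
         absolutely_integrable_on unit_simplex \<and>
       (LINT x:unit_simplex|lebesgue.
          U_fun \<alpha> \<beta> \<gamma> n m x * monomial_fun l x * jacobi_weight \<beta> \<gamma> x) = 0)"
proof (intro conjI allI impI; (elim exE)?)
  \<comment> \<open>The constants for coordinate i are \<open>a_i + s\<close> with
    \<open>1 \<le> s \<le> k_i\<close>; the choice \<open>s = l_i + 1\<close> is allowed exactly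
    when \<open>l_i < k_i\<close>.\<close>
  have factor: "(i, a $ i + real (l $ i) + 1) \<in> set (all_factors a k)" if "l $ i < k $ i"
    for a :: "real ^ 'd::{finite,linorder}" and k l :: "nat ^ 'd::{finite,linorder}" and i
    unfolding set_all_factors using that by (auto intro!: exI[of _ "Suc (l $ i)"])
  show "is_polynomial_of_degree_on (interior unit_simplex) (U_fun \<alpha> \<beta> \<gamma> n m) (vsum n + vsum m)"
    using assms(3-5) by (rule U_fun_polynomial)
  fix l i
  {
    assume "l $ i < n $ i"
    from factor[OF this, of \<alpha>] have "(i, \<alpha> $ i + real (l $ i) + 1) \<in> set (all_factors \<beta> m @ all_factors \<alpha> n)"
      by simp
    note U_fun_orthogonal[OF assms(3,5) this]
    then show "(\<lambda>x. U_fun \<alpha> \<beta> \<gamma> n m x * monomial_fun l x * jacobi_weight \<alpha> \<gamma> x)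
         absolutely_integrable_on unit_simplex"
      and "(LINT x:unit_simplex|lebesgue.
          U_fun \<alpha> \<beta> \<gamma> n m x * monomial_fun l x * jacobi_weight \<alpha> \<gamma> x) = 0" by auto
  next
    assume "l $ i < m $ i"
    from factor[OF this, of \<beta>] have "(i, \<beta> $ i + real (l $ i) + 1) \<in> set (all_factors \<beta> m @ all_factors \<alpha> n)"
      by simp
    note U_fun_orthogonal[OF assms(4,5) this]
    then show "(\<lambda>x. U_fun \<alpha> \<beta> \<gamma> n m x * monomial_fun l x * jacobi_weight \<beta> \<gamma> x)
         absolutely_integrable_on unit_simplex"
      and "(LINT x:unit_simplex|lebesgue.
          U_fun \<alpha> \<beta> \<gamma> n m x * monomial_fun l x * jacobi_weight \<beta> \<gamma> x) = 0" by auto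
  }
qed

end
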